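(* Let $\Bbbk$ be an algebraically closed field of characteristic $2$, let $\mathfrak{u}(\mathfrak{m})$ be the algebra generated by $a,b,c$ with relations $ab+ba=c$, $ac+ca=a$, $bc+cb=b$, $a^4=b^4=0$, $c^2+c=0$, let $e_0=(1+ab+a^2b^2)(1+c)$, $e_1=(1+a^2b^2)c$, $e=e_0+e_1$ and $\mathfrak{u}(\mathfrak{m})^{\mathtt b}=e\,\mathfrak{u}(\mathfrak{m})\,e$. Let $Q$ be the quiver with vertices $0,1$, two arrows $\alpha_1,\alpha_2$ from $0$ to $1$ and two arrows $\beta_1,\beta_2$ from $1$ to $0$. Then: (i) there is a surjective algebra map $\varphi:\Bbbk Q\to\mathfrak{u}(\mathfrak{m})^{\mathtt b}$ with $\varphi(\varepsilon_i)=e_i$ ($i=0,1$), $\varphi(\alpha_1)=a^3e_1$, $\varphi(\alpha_2)=be_1$, $\varphi(\beta_1)=ae_0$, $\varphi(\beta_2)=b^3e_0$, whose kernel is the ideal $$I=\langle \alpha_1\beta_1,\ \alpha_2\beta_2,\ \beta_1\alpha_1,\ \beta_2\alpha_2,\ \alpha_1\beta_2+\alpha_2\beta_1,\ \beta_1\alpha_2+\beta_2\alpha_1\rangle,$$ so that $\mathfrak{u}(\mathfrak{m})^{\mathtt b}\simeq\Bbbk Q/I$; (ii) the algebra $\mathfrak{u}(\mathfrak{m})^{\mathtt b}$ is special biserial.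
   Context: $\Bbbk Q$ is the path algebra of $Q$, $\varepsilon_i$ the trivial path at vertex $i$, and the product of paths is concatenation with $pq$ meaning "first $p$, then $q$" (so $\varepsilon_{s(\alpha)}\alpha=\alpha=\alpha\varepsilon_{t(\alpha)}$). For a bound quiver $(Q,I)$ with $I$ admissible, $\Bbbk Q/I$ is special biserial if every vertex is the source of at most two arrows and the target of at most two arrows, and for arrows $\alpha\neq\beta$ and $\gamma$: if $s(\alpha)=s(\beta)=t(\gamma)$ then $\gamma\alpha\in I$ or $\gamma\beta\in I$; if $t(\alpha)=t(\beta)=s(\gamma)$ then $\alpha\gamma\in I$ or $\beta\gamma\in I$. *)

theory Defs
  imports "HOL-Computational_Algebra.Polynomial" "HOL-Library.Poly_Mapping"
begin

datatype gen = ga | gb | gc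

type_synonym 'k fa = "gen list \<Rightarrow>\<^sub>0 'k"

definition fmul :: "'k::semiring_0 fa \<Rightarrow> 'k fa \<Rightarrow> 'k fa" where
  "fmul x y = (\<Sum>u\<in>Poly_Mapping.keys x. \<Sum>v\<in>Poly_Mapping.keys y.
      Poly_Mapping.single (u @ v) (Poly_Mapping.lookup x u * Poly_Mapping.lookup y v))"

definition fone :: "'k::{zero,one} fa" where "fone = Poly_Mapping.single [] 1"

definition fgen :: "gen \<Rightarrow> 'k::{zero,one} fa" where "fgen g = Poly_Mapping.single [g] 1"

fun fpow :: "'k::semiring_1 fa \<Rightarrow> nat \<Rightarrow> 'k fa" where
  "fpow x 0 = fone"
| "fpow x (Suc n) = fmul x (fpow x n)"

definition sc :: "'k::semiring_0 \<Rightarrow> ('p \<Rightarrow>\<^sub>0 'k) \<Rightarrow> ('p \<Rightarrow>\<^sub>0 'k)" where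
  "sc c x = Poly_Mapping.map ((*) c) x"

inductive_set gen_ideal :: "('r \<Rightarrow> 'r \<Rightarrow> 'r) \<Rightarrow> 'r set \<Rightarrow> 'r set \<Rightarrow> ('r::comm_monoid_add) set"
  for mul :: "'r \<Rightarrow> 'r \<Rightarrow> 'r" and C :: "'r set" and S :: "'r set" where
  zero: "0 \<in> gen_ideal mul C S"
| gen: "s \<in> S \<Longrightarrow> s \<in> gen_ideal mul C S"
| add: "x \<in> gen_ideal mul C S \<Longrightarrow> y \<in> gen_ideal mul C S \<Longrightarrow> x + y \<in> gen_ideal mul C S"
| left: "x \<in> gen_ideal mul C S \<Longrightarrow> u \<in> C \<Longrightarrow> mul u x \<in> gen_ideal mul C S"
| right: "x \<in> gen_ideal mul C S \<Longrightarrow> u \<in> C \<Longrightarrow> mul x u \<in> gen_ideal mul C S"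

abbreviation "A \<equiv> fgen ga"
abbreviation "B \<equiv> fgen gb"
abbreviation "C \<equiv> fgen gc"

definition um_rels :: "'k::comm_ring_1 fa set" where
  "um_rels = { fmul A B + fmul B A - C,
               fmul A C + fmul C A - A,
               fmul B C + fmul C B - B,
               fpow A 4, fpow B 4,
               fmul C C + C }"

definition um_ideal :: "'k::comm_ring_1 fa set" where
  "um_ideal = gen_ideal fmul UNIV um_rels"

definition umeq :: "'k::comm_ring_1 fa \<Rightarrow> 'k fa \<Rightarrow> bool" where
  "umeq x y \<longleftrightarrow> x - y \<in> um_ideal"

definition ue0 :: "'k::comm_ring_1 fa" where
  "ue0 = fmul (fone + fmul A B + fmul (fpow A 2) (fpow B 2)) (fone + C)"

definition ue1 :: "'k::comm_ring_1 fa" where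
  "ue1 = fmul (fone + fmul (fpow A 2) (fpow B 2)) C"

definition ue :: "'k::comm_ring_1 fa" where "ue = ue0 + ue1"

definition in_umb :: "'k::comm_ring_1 fa \<Rightarrow> bool" where
  "in_umb x \<longleftrightarrow> (\<exists>z. umeq x (fmul (fmul ue z) ue))"

text \<open>A quiver is given by source and target maps on arrows. A path is a start vertex
  together with a composable list of arrows; (v, []) is the trivial path at v.
  Concatenation p q means "first p, then q".\<close>

fun chain :: "('a \<Rightarrow> 'v) \<Rightarrow> ('a \<Rightarrow> 'v) \<Rightarrow> 'v \<Rightarrow> 'a list \<Rightarrow> bool" where
  "chain s t v [] = True"
| "chain s t v (x # xs) = (s x = v \<and> chain s t (t x) xs)"

fun pend :: "('a \<Rightarrow> 'v) \<Rightarrow> 'v \<Rightarrow> 'a list \<Rightarrow> 'v" where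
  "pend t v [] = v"
| "pend t v (x # xs) = pend t (t x) xs"

definition is_path :: "('a \<Rightarrow> 'v) \<Rightarrow> ('a \<Rightarrow> 'v) \<Rightarrow> 'v \<times> 'a list \<Rightarrow> bool" where
  "is_path s t p = chain s t (fst p) (snd p)"

definition pconcat :: "('a \<Rightarrow> 'v) \<Rightarrow> 'v \<times> 'a list \<Rightarrow> 'v \<times> 'a list \<Rightarrow> ('v \<times> 'a list) option" where
  "pconcat t p q = (if pend t (fst p) (snd p) = fst q then Some (fst p, snd p @ snd q) else None)"

definition pathalg :: "('a \<Rightarrow> 'v) \<Rightarrow> ('a \<Rightarrow> 'v) \<Rightarrow> ('v \<times> 'a list \<Rightarrow>\<^sub>0 'k::zero) set" where
  "pathalg s t = {x. \<forall>p \<in> Poly_Mapping.keys x. is_path s t p}"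

definition qmul :: "('a \<Rightarrow> 'v) \<Rightarrow> ('v \<times> 'a list \<Rightarrow>\<^sub>0 'k::semiring_0)
    \<Rightarrow> ('v \<times> 'a list \<Rightarrow>\<^sub>0 'k) \<Rightarrow> ('v \<times> 'a list \<Rightarrow>\<^sub>0 'k)" where
  "qmul t x y = (\<Sum>p\<in>Poly_Mapping.keys x. \<Sum>q\<in>Poly_Mapping.keys y.
      (case pconcat t p q of None \<Rightarrow> 0
       | Some r \<Rightarrow> Poly_Mapping.single r (Poly_Mapping.lookup x p * Poly_Mapping.lookup y q)))"

definition triv :: "'v \<Rightarrow> ('v \<times> 'a list \<Rightarrow>\<^sub>0 'k::{zero,one})" where
  "triv v = Poly_Mapping.single (v, []) 1"

definition arrow :: "('a \<Rightarrow> 'v) \<Rightarrow> 'a \<Rightarrow> ('v \<times> 'a list \<Rightarrow>\<^sub>0 'k::{zero,one})" where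
  "arrow s \<alpha> = Poly_Mapping.single (s \<alpha>, [\<alpha>]) 1"

definition arrow_ideal_pow :: "('a \<Rightarrow> 'v) \<Rightarrow> ('a \<Rightarrow> 'v) \<Rightarrow> nat \<Rightarrow> ('v \<times> 'a list \<Rightarrow>\<^sub>0 'k::zero) set" where
  "arrow_ideal_pow s t n = {x \<in> pathalg s t. \<forall>p \<in> Poly_Mapping.keys x. n \<le> length (snd p)}"

definition admissible :: "('a \<Rightarrow> 'v) \<Rightarrow> ('a \<Rightarrow> 'v) \<Rightarrow> ('v \<times> 'a list \<Rightarrow>\<^sub>0 'k::zero) set \<Rightarrow> bool" where
  "admissible s t I \<longleftrightarrow> (\<exists>m\<ge>2. arrow_ideal_pow s t m \<subseteq> I \<and> I \<subseteq> arrow_ideal_pow s t 2)"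

definition special_biserial :: "('a \<Rightarrow> 'v) \<Rightarrow> ('a \<Rightarrow> 'v) \<Rightarrow> ('v \<times> 'a list \<Rightarrow>\<^sub>0 'k::semiring_1) set \<Rightarrow> bool" where
  "special_biserial s t I \<longleftrightarrow> admissible s t I
    \<and> (\<forall>v. finite {\<alpha>. s \<alpha> = v} \<and> card {\<alpha>. s \<alpha> = v} \<le> 2
          \<and> finite {\<alpha>. t \<alpha> = v} \<and> card {\<alpha>. t \<alpha> = v} \<le> 2)
    \<and> (\<forall>\<alpha> \<beta> \<gamma>. \<alpha> \<noteq> \<beta> \<and> s \<alpha> = s \<beta> \<and> s \<beta> = t \<gamma> \<longrightarrow>
          qmul t (arrow s \<gamma>) (arrow s \<alpha>) \<in> I \<or> qmul t (arrow s \<gamma>) (arrow s \<beta>) \<in> I)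
    \<and> (\<forall>\<alpha> \<beta> \<gamma>. \<alpha> \<noteq> \<beta> \<and> t \<alpha> = t \<beta> \<and> t \<beta> = s \<gamma> \<longrightarrow>
          qmul t (arrow s \<alpha>) (arrow s \<gamma>) \<in> I \<or> qmul t (arrow s \<beta>) (arrow s \<gamma>) \<in> I)"

datatype qv = V0 | V1
datatype qa = al1 | al2 | be1 | be2

fun qs :: "qa \<Rightarrow> qv" where
  "qs al1 = V0" | "qs al2 = V0" | "qs be1 = V1" | "qs be2 = V1"
fun qt :: "qa \<Rightarrow> qv" where
  "qt al1 = V1" | "qt al2 = V1" | "qt be1 = V0" | "qt be2 = V0"

abbreviation kQ :: "(qv \<times> qa list \<Rightarrow>\<^sub>0 'k::zero) set" where "kQ \<equiv> pathalg qs qt"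
abbreviation qm :: "(qv \<times> qa list \<Rightarrow>\<^sub>0 'k::semiring_0) \<Rightarrow> _ \<Rightarrow> _" where "qm \<equiv> qmul qt"
abbreviation qarr :: "qa \<Rightarrow> (qv \<times> qa list \<Rightarrow>\<^sub>0 'k::{zero,one})" where "qarr \<equiv> arrow qs"

definition Irels :: "(qv \<times> qa list \<Rightarrow>\<^sub>0 'k::semiring_1) set" where
  "Irels = { qm (qarr al1) (qarr be1), qm (qarr al2) (qarr be2),
             qm (qarr be1) (qarr al1), qm (qarr be2) (qarr al2),
             qm (qarr al1) (qarr be2) + qm (qarr al2) (qarr be1),
             qm (qarr be1) (qarr al2) + qm (qarr be2) (qarr al1) }"

definition Iq :: "(qv \<times> qa list \<Rightarrow>\<^sub>0 'k::semiring_1) set" where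
  "Iq = gen_ideal qm kQ Irels"

end

(* Working in the PBW basis a^i b^j c^k one checks that e0, e1 are orthogonal idempotents, that the
   four images of arrows lie in the expected Peirce components and satisfy the relations of I, so phi
   is defined and kills I. For surjectivity, the left ideal u e is T = S + a e1 S + a^2 e1 S with
   S = im phi: T contains e and is stable under a and b, and e a e1 = e a^2 e1 = 0, so e u e = e T = S.
   For the kernel, every element of kQ is congruent modulo I to a combination of 8 paths of length at
   most 2. A linear relation between their images, multiplied on the right by suitable elements, ends in
   one of the socle elements a^3 e1 b^3 e0 and a e0 b e1, and these act nontrivially on explicit
   16-dimensional modules. *)
theory Submission
  imports Defs
begin

section \<open>Additive extension of coefficientwise maps on finitely supported functions\<close>

definition lext :: "('p \<Rightarrow> 'c::zero \<Rightarrow> 'm::comm_monoid_add) \<Rightarrow> ('p \<Rightarrow>\<^sub>0 'c) \<Rightarrow> 'm" where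
  "lext F x = (\<Sum>p\<in>Poly_Mapping.keys x. F p (Poly_Mapping.lookup x p))"

lemma lext_zero [simp]: "lext F 0 = 0"
  by (simp add: lext_def)

lemma lext_single: "F p 0 = 0 \<Longrightarrow> lext F (Poly_Mapping.single p c) = F p c"
  by (cases "c = 0") (simp_all add: lext_def)

text \<open>Keys may cancel in \<open>x + y\<close>; with \<open>F p 0 = 0\<close> the missing keys
  contribute nothing.\<close>

lemma lext_add:
  fixes x y :: "'p \<Rightarrow>\<^sub>0 'c::monoid_add"
  assumes "\<And>p. F p 0 = 0" "\<And>p c d. F p (c + d) = F p c + F p d"
  shows "lext F (x + y) = lext F x + lext F y"
  unfolding lext_def by (rule setsum_keys_plus_distrib) (use assms in auto)

lemma lext_sum:
  fixes f :: "'i \<Rightarrow> ('p \<Rightarrow>\<^sub>0 'c::comm_monoid_add)"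
  assumes "\<And>p. F p 0 = 0" "\<And>p c d. F p (c + d) = F p c + F p d"
  shows "lext F (sum f S) = (\<Sum>i\<in>S. lext F (f i))"
  by (induction S rule: infinite_finite_induct) (simp_all add: lext_add assms)

lemma lext_closed:
  assumes "0 \<in> M" "\<And>u v. u \<in> M \<Longrightarrow> v \<in> M \<Longrightarrow> u + v \<in> M"
    and "\<And>p. p \<in> Poly_Mapping.keys x \<Longrightarrow> F p (Poly_Mapping.lookup x p) \<in> M"
  shows "lext F x \<in> M"
proof -
  have "(\<Sum>p\<in>X. F p (Poly_Mapping.lookup x p)) \<in> M" if "X \<subseteq> Poly_Mapping.keys x" for X
    using that by (induction X rule: infinite_finite_induct) (auto intro!: assms)
  then show ?thesis by (simp add: lext_def)
qed

text \<open>Every element is the sum of its monomials. Together with \<open>lext_closed\<close> this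
  reduces membership in an additively closed set to monomials.\<close>

lemma lext_single_id: "lext Poly_Mapping.single x = x"
  by (rule poly_mapping_eqI)
    (simp add: lext_def lookup_sum lookup_single when_def in_keys_iff)

lemma lookup_sc: "Poly_Mapping.lookup (sc c x) p = c * Poly_Mapping.lookup x p"
  by (simp add: sc_def Poly_Mapping.map.rep_eq when_def)

section \<open>The algebra $u(m)$\<close>

(* With concatenation as addition on words, the convolution product of Poly_Mapping makes 'k fa a ring. *)
instantiation list :: (type) monoid_add
begin

definition "0 = []"

definition "xs + ys = xs @ (ys :: 'a list)"

instance by standard (simp_all add: zero_list_def plus_list_def)

end

lemma fmul_eq_times: "fmul x y = x * (y :: 'k::semiring_0 fa)"
proof -
  have "x * y = lext Poly_Mapping.single x * lext Poly_Mapping.single y"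
    by (simp add: lext_single_id)
  also have "\<dots> = fmul x y"
    unfolding lext_def fmul_def sum_product by (simp add: mult_single plus_list_def)
  finally show ?thesis ..
qed

lemma fone_eq_one: "fone = (1 :: 'k::semiring_1 fa)"
  by (simp add: fone_def flip: zero_list_def)

lemma fpow_eq_power: "fpow x n = (x :: 'k::semiring_1 fa) ^ n"
  by (induction n) (simp_all add: fone_eq_one fmul_eq_times)

lemma sc_eq_times: "sc c x = Poly_Mapping.single [] c * (x :: 'k::semiring_0 fa)"
  unfolding sc_def mult_map_scale_conv_mult zero_list_def ..

text \<open>A scalar sits on the empty word, neutral for concatenation, so commutativity of the
  coefficients suffices.\<close>

lemma single_central:
  "Poly_Mapping.single [] c * x = x * Poly_Mapping.single [] (c :: 'k::comm_semiring_0)"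
proof -
  have "lext Poly_Mapping.single x * Poly_Mapping.single [] c
      = Poly_Mapping.single [] c * lext Poly_Mapping.single x"
    unfolding lext_def sum_distrib_left sum_distrib_right
    by (simp add: mult_single plus_list_def mult.commute)
  then show ?thesis by (simp add: lext_single_id)
qed

lemmas um_idealI = gen_ideal.intros[where mul = fmul and C = UNIV and S = um_rels, folded um_ideal_def]

lemma um_ideal_times:
  assumes "x \<in> um_ideal"
  shows "u * x \<in> um_ideal" "x * u \<in> um_ideal"
  using um_idealI(4)[OF assms, of u] um_idealI(5)[OF assms, of u] by (simp_all add: fmul_eq_times)

lemma um_ideal_uminus: "x \<in> um_ideal \<Longrightarrow> - x \<in> (um_ideal :: 'k::comm_ring_1 fa set)"
  using um_ideal_times(1)[of x "- 1"] by simp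

lemma um_ideal_diff: "x \<in> um_ideal \<Longrightarrow> y \<in> um_ideal \<Longrightarrow> x - y \<in> (um_ideal :: 'k::comm_ring_1 fa set)"
  using um_idealI(3)[of x "- y"] um_ideal_uminus[of y] by simp

lemma equivp_umeq: "equivp (umeq :: 'k::comm_ring_1 fa \<Rightarrow> _)"
proof (rule equivpI)
  show "reflp (umeq :: 'k fa \<Rightarrow> _)" by (rule reflpI) (simp add: umeq_def um_idealI(1))
  show "symp (umeq :: 'k fa \<Rightarrow> _)"
    by (rule sympI) (use um_ideal_uminus in \<open>fastforce simp: umeq_def\<close>)
  show "transp (umeq :: 'k fa \<Rightarrow> _)"
    by (rule transpI) (use um_idealI(3) in \<open>fastforce simp: umeq_def\<close>)
qed

\<comment> \<open>In the quotient the congruence \<open>umeq\<close> becomes equality, so identities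
  can be proved by rewriting.\<close>
quotient_type (overloaded) 'k um = "'k::comm_ring_1 fa" / umeq
  by (rule equivp_umeq)

text \<open>Choosing \<open>ring\<close> and \<open>monoid_mult\<close> over \<open>ring_1\<close>
  avoids a proof that the quotient is nonzero.\<close>

instantiation um :: (comm_ring_1) "{ring,monoid_mult}"
begin

lift_definition zero_um :: "'a um" is 0 .
lift_definition one_um :: "'a um" is 1 .
lift_definition plus_um :: "'a um \<Rightarrow> 'a um \<Rightarrow> 'a um" is "(+)"
  unfolding umeq_def by (drule (1) um_idealI(3)) (simp add: algebra_simps)
lift_definition minus_um :: "'a um \<Rightarrow> 'a um \<Rightarrow> 'a um" is "(-)"
  unfolding umeq_def by (drule (1) um_ideal_diff) (simp add: algebra_simps)
lift_definition uminus_um :: "'a um \<Rightarrow> 'a um" is uminus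
  unfolding umeq_def by (drule um_ideal_uminus) (simp add: algebra_simps)
lift_definition times_um :: "'a um \<Rightarrow> 'a um \<Rightarrow> 'a um" is "(*)"
proof -
  fix x x' y y' :: "'a fa"
  assume "umeq x x'" "umeq y y'"
  then have "(x - x') * y + x' * (y - y') \<in> um_ideal"
    unfolding umeq_def by (intro um_idealI(3) um_ideal_times)
  then show "umeq (x * y) (x' * y')"
    by (simp add: umeq_def algebra_simps)
qed

instance
proof
  note eq = equivp_reflp[OF equivp_umeq]
  fix x y z :: "'a um"
  show "x + y + z = x + (y + z)" by transfer (simp add: add.assoc eq)
  show "x + y = y + x" by transfer (simp add: add.commute eq)
  show "0 + x = x" by transfer (simp add: eq)
  show "- x + x = 0" by transfer (simp add: eq)
  show "x - y = x + - y" by transfer (simp add: eq)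
  show "x * y * z = x * (y * z)" by transfer (simp add: mult.assoc eq)
  show "1 * x = x" by transfer (simp add: eq)
  show "x * 1 = x" by transfer (simp add: eq)
  show "(x + y) * z = x * z + y * z" by transfer (simp add: distrib_right eq)
  show "x * (y + z) = x * y + x * z" by transfer (simp add: distrib_left eq)
qed

end

lemma umeq_iff: "umeq x y \<longleftrightarrow> abs_um x = abs_um y"
  by (rule um.abs_eq_iff[symmetric])

lemma abs_um_rep_um: "abs_um (rep_um u) = u"
  by (rule Quotient_abs_rep[OF Quotient_um])

lemma abs_um_eq_zero_iff: "abs_um x = 0 \<longleftrightarrow> x \<in> um_ideal"
  by (simp add: zero_um_def um.abs_eq_iff umeq_def)

lemmas abs_um_hom = zero_um.abs_eq[symmetric] one_um.abs_eq[symmetric] plus_um.abs_eq[symmetric]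
  minus_um.abs_eq[symmetric] uminus_um.abs_eq[symmetric] times_um.abs_eq[symmetric]

lemma abs_um_power: "abs_um (x ^ n) = abs_um x ^ n"
  by (induction n) (simp_all add: abs_um_hom)


section \<open>PBW calculus\<close>

text \<open>The presentation, read in any ring with \<open>1 + 1 = 0\<close>. Linear independence of
  the PBW monomials is not assumed, so only consequences of the relations are derived here.\<close>

locale um_algebra =
  fixes a b c :: "'r::{ring,monoid_mult}"
  assumes two: "(1::'r) + 1 = 0"
    and ab: "a * b + b * a = c"
    and ac: "a * c + c * a = a"
    and bc: "b * c + c * b = b"
    and a4: "a ^ 4 = 0"
    and b4: "b ^ 4 = 0"
    and cc: "c * c + c = 0"
begin

lemma add_self: "x + x = (0::'r)"
  using two by (metis distrib_right mult_1 mult_zero_left)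

lemma add_self_left: "x + (x + y) = (y::'r)"
  by (simp add: add_self flip: add.assoc)

lemma eq_addI: "x + y = z \<Longrightarrow> y = x + (z::'r)"
  by (auto simp: add_self_left)

lemma ba: "b * a = a * b + c" and ca: "c * a = a * c + a" and cb: "c * b = b * c + b"
  using eq_addI[OF ab] eq_addI[OF ac] eq_addI[OF bc] by blast+

lemma c_idem: "c * c = c"
  using eq_addI[OF cc] by simp

lemma a4': "a * (a * (a * a)) = 0" and b4': "b * (b * (b * b)) = 0"
  using a4 b4 by (simp_all add: numeral_eq_Suc mult.assoc)

text \<open>After \<open>mult.assoc\<close> products are nested to the right, so each rule also
  needs a form with a tail \<open>x\<close>.\<close>

lemma left_rules:
  "b * (a * x) = a * (b * x) + c * x" "c * (a * x) = a * (c * x) + a * x"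
  "c * (b * x) = b * (c * x) + b * x" "c * (c * x) = c * x"
  "a * (a * (a * (a * x))) = 0" "b * (b * (b * (b * x))) = 0"
  using arg_cong[OF ba, of "\<lambda>y. y * x"] arg_cong[OF ca, of "\<lambda>y. y * x"]
    arg_cong[OF cb, of "\<lambda>y. y * x"] arg_cong[OF c_idem, of "\<lambda>y. y * x"]
    arg_cong[OF a4', of "\<lambda>y. y * x"] arg_cong[OF b4', of "\<lambda>y. y * x"]
  by (simp_all only: distrib_right mult.assoc mult_zero_left)

(* Rewriting with these rules computes the PBW normal form, a sum of monomials a^i b^j c^k. *)
lemmas pbw = distrib_left distrib_right mult.assoc ba ca cb c_idem a4' b4' left_rules
  add_self add_self_left add_ac

definition e0 :: 'r where "e0 = (1 + a * b + a ^ 2 * b ^ 2) * (1 + c)"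
definition e1 :: 'r where "e1 = (1 + a ^ 2 * b ^ 2) * c"

lemma e_pbw:
  "e0 = 1 + c + a * b + a * (b * c) + a * (a * (b * b)) + a * (a * (b * (b * c)))"
  "e1 = c + a * (a * (b * (b * c)))"
  by (simp_all add: e0_def e1_def power2_eq_square pbw)

fun E :: "qv \<Rightarrow> 'r" where
  "E V0 = e0" | "E V1 = e1"

fun R :: "qa \<Rightarrow> 'r" where
  "R al1 = a ^ 3 * e1" | "R al2 = b * e1" | "R be1 = a * e0" | "R be2 = b ^ 3 * e0"

lemma R_pbw:
  "R al1 = a * (a * (a * c))"
  "R al2 = b * c + a * (b * (b * c)) + a * (a * (b * (b * (b * c))))"
  "R be1 = a + a * c + a * (a * b) + a * (a * (b * c)) + a * (a * (a * (b * b)))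
     + a * (a * (a * (b * (b * c))))"
  "R be2 = b * (b * b) + b * (b * (b * c))"
  by (simp_all add: power3_eq_cube e_pbw pbw)

lemma E_E: "E v * E w = (if v = w then E v else 0)"
  by (cases v; cases w) (simp_all add: e_pbw pbw)

lemma E_R: "E (qs x) * R x = R x"
  by (cases x) (simp_all add: e_pbw R_pbw pbw del: R.simps)

lemma R_E: "R x * E (qt x) = R x"
  by (cases x) (simp_all add: e_pbw R_pbw pbw del: R.simps)

lemma R_R:
  "R al1 * R be1 = 0" "R al2 * R be2 = 0" "R be1 * R al1 = 0" "R be2 * R al2 = 0"
  "R al2 * R be1 = R al1 * R be2" "R be2 * R al1 = R be1 * R al2"
  by (simp_all add: e_pbw R_pbw pbw del: R.simps)

text \<open>These are the images of the two paths of length 2 that survive modulo the relations. The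
  kernel computation comes down to no nonzero scalar killing them.\<close>

lemma socle_pbw:
  "R al1 * R be2 = a * (a * (a * (b * (b * b)))) + a * (a * (a * (b * (b * (b * c)))))"
  "R be1 * R al2 = a * (b * c) + a * (a * (b * (b * c))) + a * (a * (a * (b * (b * (b * c)))))"
  by (simp_all add: e_pbw R_pbw pbw del: R.simps)

abbreviation "g1 \<equiv> a * e1"
abbreviation "g2 \<equiv> a * (a * e1)"

text \<open>Multiplying \<open>e0\<close>, \<open>e1\<close>, \<open>g1\<close>, \<open>g2\<close>
  on the left by \<open>a\<close> or \<open>b\<close> gives right combinations of these elements
  with coefficients in the image of the path algebra. The last two rules let the corner idempotent
  discard \<open>g1\<close> and \<open>g2\<close>.\<close>

lemma generator_rules:
  "a * e0 = R be1" "a * g2 = R al1" "b * e0 = g2 * R be2" "b * e1 = R al2"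
  "b * g1 = e1 + R be1 * R al2" "b * g2 = g1 * (e1 + R be1 * R al2)"
  "(e0 + e1) * g1 = 0" "(e0 + e1) * g2 = 0"
  by (simp_all add: e_pbw R_pbw pbw del: R.simps)

end


section \<open>Path algebras and the ideal $I$\<close>

text \<open>One summand of \<open>qmul\<close> with its coefficient left free, so that the
  additivity lemmas for \<open>lext\<close> apply.\<close>

definition pterm :: "('a \<Rightarrow> 'v) \<Rightarrow> 'v \<times> 'a list \<Rightarrow> 'v \<times> 'a list \<Rightarrow> 'k \<Rightarrow> ('v \<times> 'a list \<Rightarrow>\<^sub>0 'k::zero)" where
  "pterm t p q k = (case pconcat t p q of None \<Rightarrow> 0 | Some r \<Rightarrow> Poly_Mapping.single r k)"

lemma pterm_zero [simp]: "pterm t p q 0 = 0"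
  by (simp add: pterm_def split: option.split)

lemma pterm_add: "pterm t p q (k + l) = pterm t p q k + pterm t p q (l :: 'k::monoid_add)"
  by (simp add: pterm_def single_add split: option.split)

lemma qmul_eq_lext:
  "qmul t x y = lext (\<lambda>p k. lext (\<lambda>q l. pterm t p q (k * l)) y) x"
  by (simp add: qmul_def lext_def pterm_def)

lemma qmul_single:
  "qmul t (Poly_Mapping.single (v, u) k) (Poly_Mapping.single (v', w) l)
    = (if pend t v u = v' then Poly_Mapping.single (v, u @ w) (k * l) else 0)"
proof -
  have "qmul t (Poly_Mapping.single (v, u) k) (Poly_Mapping.single (v', w) l)
      = pterm t (v, u) (v', w) (k * l)"
    by (simp add: qmul_eq_lext lext_single lext_def)
  then show ?thesis by (simp add: pterm_def pconcat_def)
qed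

lemma qmul_add_left: "qmul t (x + y) z = qmul t x z + qmul t y z"
  unfolding qmul_eq_lext
  by (rule lext_add) (simp_all add: lext_def distrib_right pterm_add sum.distrib)

lemma pathalg_zero: "0 \<in> pathalg s t"
  by (simp add: pathalg_def)

lemma pathalg_single: "chain s t v w \<Longrightarrow> Poly_Mapping.single (v, w) k \<in> pathalg s t"
  by (simp add: pathalg_def is_path_def)

lemma pathalg_add: "x \<in> pathalg s t \<Longrightarrow> y \<in> pathalg s t \<Longrightarrow> x + y \<in> pathalg s t"
  using keys_add[of x y] by (auto simp: pathalg_def)

lemma pathalg_keysD: "x \<in> pathalg s t \<Longrightarrow> (v, w) \<in> Poly_Mapping.keys x \<Longrightarrow> chain s t v w"
  by (auto simp: pathalg_def is_path_def)

lemma chain_append: "chain s t v (u @ w) \<longleftrightarrow> chain s t v u \<and> chain s t (pend t v u) w"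
  by (induction u arbitrary: v) auto

text \<open>Bounding the sum of the two lengths covers several uses: \<open>n = 0\<close> gives
  closure of the path algebra, and a bound on one factor alone gives the ideal property.\<close>

lemma arrow_ideal_pow_qmul:
  fixes x y :: "'v \<times> 'a list \<Rightarrow>\<^sub>0 'k::semiring_0"
  assumes "x \<in> pathalg s t" "y \<in> pathalg s t"
    and "\<And>p q. p \<in> Poly_Mapping.keys x \<Longrightarrow> q \<in> Poly_Mapping.keys y \<Longrightarrow>
      n \<le> length (snd p) + length (snd q)"
  shows "qmul t x y \<in> arrow_ideal_pow s t n"
proof -
  have zero: "0 \<in> arrow_ideal_pow s t n"
    by (simp add: arrow_ideal_pow_def pathalg_zero)
  have add: "u + v \<in> arrow_ideal_pow s t n"
    if "u \<in> arrow_ideal_pow s t n" "v \<in> arrow_ideal_pow s t n" for u v :: "'v \<times> 'a list \<Rightarrow>\<^sub>0 'k"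
    using that keys_add[of u v] by (auto simp: arrow_ideal_pow_def pathalg_add)
  have "pterm t p q k \<in> arrow_ideal_pow s t n"
    if "p \<in> Poly_Mapping.keys x" "q \<in> Poly_Mapping.keys y" for p q k
    using assms that pathalg_keysD[OF assms(1), of "fst p" "snd p"]
      pathalg_keysD[OF assms(2), of "fst q" "snd q"]
    by (auto simp: pterm_def pconcat_def zero arrow_ideal_pow_def pathalg_def is_path_def
        chain_append split: option.splits)
  then show ?thesis
    unfolding qmul_eq_lext by (intro lext_closed zero add)
qed

lemma pathalg_qmul: "x \<in> pathalg s t \<Longrightarrow> y \<in> pathalg s t \<Longrightarrow> qmul t x y \<in> pathalg s t"
  using arrow_ideal_pow_qmul[of x s t y 0] by (simp add: arrow_ideal_pow_def)

lemma sc_single: "sc c (Poly_Mapping.single p k) = Poly_Mapping.single p (c * k)"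
  by (simp add: sc_def)

lemma sc_one: "sc 1 x = (x :: 'p \<Rightarrow>\<^sub>0 'k::semiring_1)"
  by (rule poly_mapping_eqI) (simp add: lookup_sc)

lemma sc_pathalg: "x \<in> pathalg s t \<Longrightarrow> sc c x \<in> pathalg s t"
  by (auto simp: pathalg_def in_keys_iff lookup_sc)

text \<open>The sum of the trivial paths is a left unit. Its multiples turn scaling into a product
  inside the path algebra, so ideals closed under products are closed under scalars, and
  multiplicative maps can be checked for linearity.\<close>

lemma qm_unit:
  "qm (Poly_Mapping.single (V0, []) c + Poly_Mapping.single (V1, []) c) x = sc c x"
proof -
  have *: "qm (Poly_Mapping.single (v, []) c) x = (\<Sum>p\<in>Poly_Mapping.keys x.
      if v = fst p then Poly_Mapping.single p (c * Poly_Mapping.lookup x p) else 0)" for v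
  proof -
    have "qm (Poly_Mapping.single (v, []) c) x = lext (\<lambda>q l. pterm qt (v, []) q (c * l)) x"
      unfolding qmul_eq_lext by (rule lext_single) (simp add: lext_def)
    then show ?thesis
      by (auto simp: lext_def pterm_def pconcat_def intro!: sum.cong)
  qed
  have "qm (Poly_Mapping.single (V0, []) c + Poly_Mapping.single (V1, []) c) x
      = (\<Sum>p\<in>Poly_Mapping.keys x. Poly_Mapping.single p (c * Poly_Mapping.lookup x p))"
    unfolding qmul_add_left * sum.distrib[symmetric]
  proof (rule sum.cong)
    fix p show "(if V0 = fst p then Poly_Mapping.single p (c * Poly_Mapping.lookup x p) else 0)
        + (if V1 = fst p then Poly_Mapping.single p (c * Poly_Mapping.lookup x p) else 0)
        = Poly_Mapping.single p (c * Poly_Mapping.lookup x p)"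
      by (cases "fst p") auto
  qed simp
  also have "\<dots> = sc c x"
    by (rule poly_mapping_eqI)
      (auto simp: lookup_sum lookup_single when_def in_keys_iff lookup_sc)
  finally show ?thesis .
qed

section \<open>Reduction of paths modulo the relations, and admissibility of the ideal\<close>

type_synonym 'k kq = "qv \<times> qa list \<Rightarrow>\<^sub>0 'k"

lemma arrow_in_pathalg: "arrow s x \<in> pathalg s t"
  by (simp add: arrow_def pathalg_single)

lemma qm_arrow:
  "qm (qarr x) (qarr y :: 'k::semiring_1 kq) = (if qt x = qs y then Poly_Mapping.single (qs x, [x, y]) 1 else 0)"
  by (simp add: arrow_def qmul_single)

lemma Irels_subset: "(Irels :: 'k::semiring_1 kq set) \<subseteq> arrow_ideal_pow qs qt 2"
proof -
  have "Poly_Mapping.keys (Poly_Mapping.single p 1 + Poly_Mapping.single q (1::'k)) \<subseteq> {p, q}"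
    for p q :: "qv \<times> qa list"
    using keys_add[of "Poly_Mapping.single p 1" "Poly_Mapping.single q (1::'k)"] by auto
  then show ?thesis
    by (auto simp: Irels_def qm_arrow arrow_ideal_pow_def pathalg_single pathalg_add) force+
qed

lemma Iq_subset: "(Iq :: 'k::semiring_1 kq set) \<subseteq> arrow_ideal_pow qs qt 2"
proof
  fix x :: "qv \<times> qa list \<Rightarrow>\<^sub>0 'k" assume "x \<in> Iq"
  then show "x \<in> arrow_ideal_pow qs qt 2"
    unfolding Iq_def
  proof induction
    case (add x y)
    then show ?case using keys_add[of x y] by (auto simp: arrow_ideal_pow_def pathalg_add)
  next
    case (left x u)
    then show ?case by (intro arrow_ideal_pow_qmul) (auto simp: arrow_ideal_pow_def trans_le_add2)
  next
    case (right x u)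
    then show ?case by (intro arrow_ideal_pow_qmul) (auto simp: arrow_ideal_pow_def trans_le_add1)
  qed (use Irels_subset in \<open>auto simp: arrow_ideal_pow_def pathalg_zero\<close>)
qed

lemmas IqI = gen_ideal.intros[where mul = qm and C = kQ and S = Irels, folded Iq_def]

lemma Iq_sc:
  assumes "x \<in> Iq" shows "sc c x \<in> Iq"
  unfolding qm_unit[symmetric] using assms by (intro IqI(4) pathalg_add pathalg_single) simp_all

lemma Iq_diff: "x \<in> Iq \<Longrightarrow> y \<in> Iq \<Longrightarrow> x - y \<in> (Iq :: 'k::comm_ring_1 kq set)"
proof -
  assume "x \<in> Iq" "y \<in> Iq"
  then have "x + sc (- 1) y \<in> Iq" by (intro IqI(3) Iq_sc)
  moreover have "sc (- 1) y = - y" by (rule poly_mapping_eqI) (simp add: lookup_sc)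
  ultimately show ?thesis by simp
qed

abbreviation mono_path :: "qa list \<Rightarrow> (qv \<times> qa list \<Rightarrow>\<^sub>0 'k::{zero,one})" where
  "mono_path w \<equiv> Poly_Mapping.single (qs (hd w), w) 1"

lemma Iq_length2:
  "mono_path [al1, be1] \<in> (Iq :: 'k::comm_ring_1 kq set)" "mono_path [al2, be2] \<in> (Iq :: 'k::comm_ring_1 kq set)"
  "mono_path [be1, al1] \<in> (Iq :: 'k::comm_ring_1 kq set)" "mono_path [be2, al2] \<in> (Iq :: 'k::comm_ring_1 kq set)"
  "mono_path [al1, be2] + mono_path [al2, be1] \<in> (Iq :: 'k::comm_ring_1 kq set)"
  "mono_path [be1, al2] + mono_path [be2, al1] \<in> (Iq :: 'k::comm_ring_1 kq set)"
  by (rule IqI(2), simp add: Irels_def qm_arrow)+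

lemma Iq_append_right:
  assumes "Poly_Mapping.single (v, u) 1 \<in> (Iq :: 'k::comm_ring_1 kq set)" "chain qs qt (pend qt v u) w"
  shows "Poly_Mapping.single (v, u @ w) k \<in> (Iq :: 'k::comm_ring_1 kq set)"
  using IqI(5)[OF assms(1) pathalg_single[OF assms(2), of k]] by (simp add: qmul_single)

lemma Iq_append_left:
  assumes "Poly_Mapping.single (pend qt v u, w) 1 \<in> (Iq :: 'k::comm_ring_1 kq set)" "chain qs qt v u"
  shows "Poly_Mapping.single (v, u @ w) k \<in> (Iq :: 'k::comm_ring_1 kq set)"
  using IqI(4)[OF assms(1) pathalg_single[OF assms(2), of k]] by (simp add: qmul_single)

text \<open>Multiply the binomial relation by \<open>z\<close> on the right; its second term then
  contains the relation \<open>y' z\<close> and drops out.\<close>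

lemma Iq_overlap:
  assumes "mono_path [x, y] + mono_path [x', y'] \<in> (Iq :: 'k::comm_ring_1 kq set)"
    and "mono_path [y', z] \<in> (Iq :: 'k kq set)"
    and "qt x' = qs y'" "qt y = qs z" "qt y' = qs z"
  shows "mono_path [x, y, z] \<in> (Iq :: 'k kq set)"
proof -
  have "qm (mono_path [x, y] + mono_path [x', y']) (qarr z) \<in> (Iq :: 'k kq set)"
    using assms(1) by (rule IqI(5)) (rule arrow_in_pathalg)
  then have "mono_path [x, y, z] + mono_path [x', y', z] \<in> (Iq :: 'k kq set)"
    using assms by (simp add: qmul_add_left arrow_def qmul_single)
  moreover have "mono_path [x', y', z] \<in> (Iq :: 'k kq set)"
    using Iq_append_left[of "qs x'" "[x']" "[y', z]" 1] assms by simp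
  ultimately show ?thesis using Iq_diff by fastforce
qed

text \<open>Either two consecutive arrows form a monomial relation, or the path is one of the four
  alternating ones, such as \<open>al1 be2 al1\<close>, which \<open>Iq_overlap\<close>
  handles.\<close>

lemma Iq_length3:
  assumes "qt x = qs y" "qt y = qs z"
  shows "mono_path [x, y, z] \<in> (Iq :: 'k::comm_ring_1 kq set)"
proof -
  have "mono_path [x, y, z] \<in> (Iq :: 'k kq set)"
    if "mono_path [x, y] \<in> (Iq :: 'k kq set)"
    using Iq_append_right[of "qs x" "[x, y]" "[z]" 1] that assms by simp
  moreover have "mono_path [x, y, z] \<in> (Iq :: 'k kq set)"
    if "mono_path [y, z] \<in> (Iq :: 'k kq set)"
    using Iq_append_left[of "qs x" "[x]" "[y, z]" 1] that assms by simp
  moreover have "mono_path [al1, be2, al1] \<in> (Iq :: 'k kq set)"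
    "mono_path [be1, al2, be1] \<in> (Iq :: 'k kq set)"
    by (rule Iq_overlap[OF Iq_length2(5) Iq_length2(3)] Iq_overlap[OF Iq_length2(6) Iq_length2(1)]; simp)+
  moreover have "mono_path [al2, be1, al2] \<in> (Iq :: 'k kq set)"
    by (rule Iq_overlap[where x' = al1 and y' = be2])
      (use Iq_length2 in \<open>simp_all add: add.commute\<close>)
  moreover have "mono_path [be2, al1, be2] \<in> (Iq :: 'k kq set)"
    by (rule Iq_overlap[where x' = be1 and y' = al2])
      (use Iq_length2 in \<open>simp_all add: add.commute\<close>)
  ultimately show ?thesis
    using assms Iq_length2(1-4)[where 'k = 'k] by (cases x; cases y; cases z; simp)
qed

lemma Iq_length_ge3:
  assumes "chain qs qt v w" "3 \<le> length w"
  shows "Poly_Mapping.single (v, w) k \<in> (Iq :: 'k::comm_ring_1 kq set)"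
proof -
  obtain x y z w' where "w = [x, y, z] @ w'"
    using assms(2) by (auto simp: numeral_eq_Suc Suc_le_length_iff)
  then show ?thesis
    using assms(1) Iq_append_right[of v "[x, y, z]" w' k] Iq_length3[of x y z] by simp
qed

definition comb :: "'k \<Rightarrow> 'k \<Rightarrow> 'k \<Rightarrow> 'k \<Rightarrow> 'k \<Rightarrow> 'k \<Rightarrow> 'k \<Rightarrow> 'k \<Rightarrow> (qv \<times> qa list \<Rightarrow>\<^sub>0 'k::monoid_add)" where
  "comb k0 k1 k2 k3 k4 k5 k6 k7 =
    Poly_Mapping.single (V0, []) k0 + Poly_Mapping.single (V1, []) k1
    + Poly_Mapping.single (V0, [al1]) k2 + Poly_Mapping.single (V0, [al2]) k3
    + Poly_Mapping.single (V1, [be1]) k4 + Poly_Mapping.single (V1, [be2]) k5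
    + Poly_Mapping.single (V0, [al1, be2]) k6 + Poly_Mapping.single (V1, [be1, al2]) k7"

text \<open>The reducible elements form an additively closed set \<open>M\<close>, so only scaled
  paths need checking: paths of length at least 3 lie in \<open>Iq\<close>, shorter ones are treated
  one by one.\<close>

lemma Iq_comb:
  fixes x :: "qv \<times> qa list \<Rightarrow>\<^sub>0 'k::comm_ring_1"
  assumes "x \<in> kQ"
  shows "\<exists>k0 k1 k2 k3 k4 k5 k6 k7. x - comb k0 k1 k2 k3 k4 k5 k6 k7 \<in> Iq"
proof -
  define M where "M = {x :: qv \<times> qa list \<Rightarrow>\<^sub>0 'k.
    \<exists>k0 k1 k2 k3 k4 k5 k6 k7. x - comb k0 k1 k2 k3 k4 k5 k6 k7 \<in> Iq}"
  have M_I: "x \<in> M" if "x - comb k0 k1 k2 k3 k4 k5 k6 k7 \<in> Iq" for x k0 k1 k2 k3 k4 k5 k6 k7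
    unfolding M_def using that by blast
  have Iq_M: "x \<in> M" if "x \<in> Iq" for x
    by (rule M_I[of _ 0 0 0 0 0 0 0 0]) (use that in \<open>simp add: comb_def\<close>)
  have "Poly_Mapping.single (v, w) k \<in> M" if w: "chain qs qt v w" for v w k
  proof -
    consider "w = []" | x where "w = [x]" | x y where "w = [x, y]" | "3 \<le> length w"
      by (cases w rule: remdups_adj.cases) (auto simp: numeral_eq_Suc Suc_le_eq)
    then show ?thesis
    proof cases
      case 1
      have "Poly_Mapping.single (V0, []) k \<in> M"
        by (rule M_I[of _ k 0 0 0 0 0 0 0]) (simp add: comb_def IqI(1))
      moreover have "Poly_Mapping.single (V1, []) k \<in> M"
        by (rule M_I[of _ 0 k 0 0 0 0 0 0]) (simp add: comb_def IqI(1))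
      ultimately show ?thesis using 1 by (cases v) auto
    next
      case (2 x)
      have "Poly_Mapping.single (V0, [al1]) k \<in> M"
        by (rule M_I[of _ 0 0 k 0 0 0 0 0]) (simp add: comb_def IqI(1))
      moreover have "Poly_Mapping.single (V0, [al2]) k \<in> M"
        by (rule M_I[of _ 0 0 0 k 0 0 0 0]) (simp add: comb_def IqI(1))
      moreover have "Poly_Mapping.single (V1, [be1]) k \<in> M"
        by (rule M_I[of _ 0 0 0 0 k 0 0 0]) (simp add: comb_def IqI(1))
      moreover have "Poly_Mapping.single (V1, [be2]) k \<in> M"
        by (rule M_I[of _ 0 0 0 0 0 k 0 0]) (simp add: comb_def IqI(1))
      ultimately show ?thesis using 2 w by (cases x) auto
    next
      case (3 x y)
      have sc: "sc k z \<in> Iq" if "z \<in> Iq" for z :: "qv \<times> qa list \<Rightarrow>\<^sub>0 'k"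
        using that by (rule Iq_sc)
      have sc_add: "sc k (u + v) = sc k u + sc k v" for u v :: "qv \<times> qa list \<Rightarrow>\<^sub>0 'k"
        by (rule poly_mapping_eqI) (simp add: lookup_sc lookup_add distrib_left)
      note rels = Iq_length2[where 'k = 'k, THEN sc, unfolded sc_add sc_single]
      have "Poly_Mapping.single (V0, [al1, be2]) k \<in> M"
        by (rule M_I[of _ 0 0 0 0 0 0 k 0]) (simp add: comb_def IqI(1))
      moreover have "Poly_Mapping.single (V1, [be1, al2]) k \<in> M"
        by (rule M_I[of _ 0 0 0 0 0 0 0 k]) (simp add: comb_def IqI(1))
      \<comment> \<open>The binomial relation replaces \<open>al2 be1\<close> by minus
        \<open>al1 be2\<close>; the sign stays because the coefficients are not yet of
        characteristic 2.\<close>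
      moreover have "Poly_Mapping.single (V0, [al2, be1]) k \<in> M"
        by (rule M_I[of _ 0 0 0 0 0 0 "- k" 0])
          (use rels(5) in \<open>simp add: comb_def single_uminus add.commute\<close>)
      moreover have "Poly_Mapping.single (V1, [be2, al1]) k \<in> M"
        by (rule M_I[of _ 0 0 0 0 0 0 0 "- k"])
          (use rels(6) in \<open>simp add: comb_def single_uminus add.commute\<close>)
      ultimately show ?thesis using 3 w rels(1-4)[THEN Iq_M] by (cases x; cases y) auto
    next
      case 4
      then show ?thesis using w by (intro Iq_M Iq_length_ge3)
    qed
  qed
  then have "lext Poly_Mapping.single x \<in> M"
  proof (intro lext_closed)
    show "0 \<in> M" by (rule Iq_M[OF IqI(1)])
  next
    fix u v assume "u \<in> M" "v \<in> M"
    then obtain k0 k1 k2 k3 k4 k5 k6 k7 l0 l1 l2 l3 l4 l5 l6 l7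
      where "u - comb k0 k1 k2 k3 k4 k5 k6 k7 \<in> Iq" "v - comb l0 l1 l2 l3 l4 l5 l6 l7 \<in> Iq"
      unfolding M_def by blast
    then have "(u - comb k0 k1 k2 k3 k4 k5 k6 k7) + (v - comb l0 l1 l2 l3 l4 l5 l6 l7) \<in> Iq"
      by (rule IqI(3))
    then show "u + v \<in> M"
      by (intro M_I[of _ "k0 + l0" "k1 + l1" "k2 + l2" "k3 + l3" "k4 + l4" "k5 + l5" "k6 + l6" "k7 + l7"])
        (simp add: comb_def single_add algebra_simps)
  qed (use assms in \<open>auto dest: pathalg_keysD\<close>)
  then show ?thesis by (simp add: lext_single_id M_def)
qed

lemma special_biserial_Iq: "special_biserial qs qt (Iq :: 'k::comm_ring_1 kq set)"
proof -
  \<comment> \<open>Admissibility holds with exponent 3, as all paths of length 3 or more lie in the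
    ideal.\<close>
  have "x \<in> Iq" if "x \<in> arrow_ideal_pow qs qt 3" for x :: "qv \<times> qa list \<Rightarrow>\<^sub>0 'k"
  proof -
    have "lext Poly_Mapping.single x \<in> Iq"
      by (intro lext_closed IqI(1) IqI(3)) (use that in \<open>auto simp: arrow_ideal_pow_def
        intro!: Iq_length_ge3 dest: pathalg_keysD\<close>)
    then show ?thesis by (simp add: lext_single_id)
  qed
  then have "admissible qs qt (Iq :: 'k kq set)"
    using Iq_subset unfolding admissible_def by (intro exI[of _ 3]) auto
  moreover have "{x. qs x = v} = (if v = V0 then {al1, al2} else {be1, be2})"
    "{x. qt x = v} = (if v = V0 then {be1, be2} else {al1, al2})" for v
    by (cases v; auto elim: qs.elims qt.elims)+
  moreover have "qm (qarr z) (qarr x) \<in> (Iq :: 'k kq set) \<or> qm (qarr z) (qarr y) \<in> (Iq :: 'k kq set)"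
    if "x \<noteq> y" "qs x = qs y" "qs y = qt z" for x y z
    using that Iq_length2(1-4)[where 'k = 'k]
    by (cases x; cases y; cases z; simp add: qm_arrow)
  moreover have "qm (qarr x) (qarr z) \<in> (Iq :: 'k kq set) \<or> qm (qarr y) (qarr z) \<in> (Iq :: 'k kq set)"
    if "x \<noteq> y" "qt x = qt y" "qt y = qs z" for x y z
    using that Iq_length2(1-4)[where 'k = 'k]
    by (cases x; cases y; cases z; simp add: qm_arrow)
  ultimately show ?thesis
    unfolding special_biserial_def by auto
qed

section \<open>The map from the path algebra\<close>

text \<open>Scalars act through a ring map \<open>K\<close> with central image, which stands in for
  a vector space structure on \<open>'r\<close>.\<close>

locale um_kalgebra = um_algebra a b c for a b c :: "'r::{ring,monoid_mult}" +
  fixes K :: "'k::comm_ring_1 \<Rightarrow> 'r"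
  assumes K_add: "K (k + l) = K k + K l"
    and K_mult: "K (k * l) = K k * K l"
    and K_one: "K 1 = 1"
    and K_central: "K k * x = x * K k"
begin

lemma K_zero: "K 0 = 0"
  using K_add[of 0 0] by simp

lemma K_left_commute: "x * (K k * y) = K k * (x * y)"
  by (metis K_central mult.assoc)

text \<open>Image of a path. The closing idempotent serves the trivial paths and is absorbed by
  \<open>R_E\<close> in all others.\<close>

fun W :: "qv \<Rightarrow> qa list \<Rightarrow> 'r" where
  "W v [] = E v"
| "W v (x # w) = R x * W (qt x) w"

lemma W_left: "chain qs qt v w \<Longrightarrow> E v * W v w = W v w"
  by (cases w) (auto simp: E_E E_R simp del: E.simps R.simps simp flip: mult.assoc)

lemma W_right: "chain qs qt v w \<Longrightarrow> W v w * E (pend qt v w) = W v w"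
  by (induction w arbitrary: v) (auto simp: E_E mult.assoc simp del: E.simps R.simps)

lemma W_append:
  "chain qs qt v u \<Longrightarrow> chain qs qt (pend qt v u) w \<Longrightarrow> W v (u @ w) = W v u * W (pend qt v u) w"
  by (induction u arbitrary: v) (auto simp: W_left mult.assoc simp del: E.simps R.simps)

lemma W_orthogonal:
  assumes "chain qs qt v u" "chain qs qt v' w" "pend qt v u \<noteq> v'"
  shows "W v u * W v' w = 0"
proof -
  have "W v u * W v' w = (W v u * E (pend qt v u)) * (E v' * W v' w)"
    by (simp only: W_left W_right assms)
  also have "\<dots> = W v u * (E (pend qt v u) * E v') * W v' w"
    by (simp only: mult.assoc)
  also have "\<dots> = 0" by (simp add: E_E assms del: E.simps)
  finally show ?thesis .
qed

definition Phi :: "(qv \<times> qa list \<Rightarrow>\<^sub>0 'k) \<Rightarrow> 'r" where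
  "Phi = lext (\<lambda>p k. K k * W (fst p) (snd p))"

lemma Phi_single: "Phi (Poly_Mapping.single (v, w) k) = K k * W v w"
  by (simp add: Phi_def lext_single K_zero)

lemma Phi_zero [simp]: "Phi 0 = 0"
  by (simp add: Phi_def)

lemma Phi_add: "Phi (x + y) = Phi x + Phi y"
  unfolding Phi_def by (rule lext_add) (simp_all add: K_zero K_add distrib_right)

lemma Phi_sum: "Phi (sum f S) = (\<Sum>i\<in>S. Phi (f i))"
  unfolding Phi_def by (rule lext_sum) (simp_all add: K_zero K_add distrib_right)

lemma Phi_triv: "Phi (triv v) = E v"
  by (simp add: triv_def Phi_single K_one del: E.simps)

lemma Phi_arrow: "Phi (qarr x) = R x"
  by (simp add: arrow_def Phi_single K_one R_E del: E.simps R.simps)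

lemma Phi_pterm:
  assumes "is_path qs qt p" "is_path qs qt q"
  shows "Phi (pterm qt p q (k * l)) = K k * W (fst p) (snd p) * (K l * W (fst q) (snd q))"
proof -
  have "K k * W (fst p) (snd p) * (K l * W (fst q) (snd q))
      = K (k * l) * (W (fst p) (snd p) * W (fst q) (snd q))"
    by (simp only: K_mult mult.assoc) (simp only: K_left_commute[of "W (fst p) (snd p)"])
  then show ?thesis
    using assms by (auto simp: pterm_def pconcat_def Phi_single W_append W_orthogonal is_path_def)
qed

lemma Phi_qmul:
  assumes "x \<in> kQ" "y \<in> kQ"
  shows "Phi (qm x y) = Phi x * Phi y"
  using assms unfolding qmul_eq_lext lext_def Phi_sum
  by (auto simp: Phi_def lext_def[of _ x] lext_def[of _ y] sum_product pathalg_def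
      Phi_pterm[unfolded Phi_def] intro!: sum.cong)

text \<open>By \<open>qm_unit\<close> scaling is a product, so multiplicativity yields the factor
  \<open>K k\<close> times \<open>E V0 + E V1\<close>; the case of scalar 1 absorbs the second
  part.\<close>

lemma Phi_sc: "Phi (sc k x) = K k * Phi x" if "x \<in> kQ"
proof -
  have "Phi (sc k x) = (K k * (E V0 + E V1)) * Phi x"
    unfolding qm_unit[symmetric]
    by (subst Phi_qmul) (use that in \<open>auto intro!: pathalg_add pathalg_single
      simp: Phi_add Phi_single distrib_left\<close>)
  also have "(E V0 + E V1) * Phi x = Phi (sc 1 x)"
    unfolding qm_unit[symmetric]
    by (subst Phi_qmul) (use that in \<open>auto intro!: pathalg_add pathalg_single
      simp: Phi_add Phi_single K_one\<close>)
  then have "(K k * (E V0 + E V1)) * Phi x = K k * Phi (sc 1 x)"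
    by (simp only: mult.assoc)
  finally show ?thesis by (simp only: sc_one)
qed

lemma Phi_unit:
  assumes "x \<in> kQ"
  shows "(e0 + e1) * Phi x = Phi x" "Phi x * (e0 + e1) = Phi x"
proof -
  have "W v w * (e0 + e1) = W v w" if "chain qs qt v w" for v w
  proof -
    have "W v w * (E V0 + E V1) = W v w * E (pend qt v w) * (E V0 + E V1)"
      by (simp only: W_right that)
    also have "\<dots> = W v w * (E (pend qt v w) * (E V0 + E V1))"
      by (simp only: mult.assoc)
    also have "E (pend qt v w) * (E V0 + E V1) = E (pend qt v w)"
      by (cases "pend qt v w") (simp_all add: distrib_left E_E del: E.simps)
    finally show ?thesis by (simp add: W_right that)
  qed
  then have "K k * W v w * (e0 + e1) = K k * W v w" if "chain qs qt v w" for v w k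
    using that by (simp add: mult.assoc)
  then show "Phi x * (e0 + e1) = Phi x"
    using assms by (auto simp: Phi_def lext_def sum_distrib_right pathalg_def is_path_def intro!: sum.cong)
  have "Phi (sc 1 x) = (e0 + e1) * Phi x"
    unfolding qm_unit[symmetric]
    by (subst Phi_qmul) (use assms in \<open>auto intro!: pathalg_add pathalg_single
      simp: Phi_add Phi_single K_one\<close>)
  then show "(e0 + e1) * Phi x = Phi x" by (simp add: sc_one)
qed

section \<open>Surjectivity onto the corner algebra\<close>

definition S where "S = Phi ` kQ"

lemma S_add: "x \<in> S \<Longrightarrow> y \<in> S \<Longrightarrow> x + y \<in> S"
  by (auto simp: S_def simp flip: Phi_add intro!: imageI pathalg_add)

lemma S_mult: "x \<in> S \<Longrightarrow> y \<in> S \<Longrightarrow> x * y \<in> S"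
  by (auto simp: S_def simp flip: Phi_qmul intro!: imageI pathalg_qmul)

lemma S_scale: "x \<in> S \<Longrightarrow> K k * x \<in> S"
  by (auto simp: S_def simp flip: Phi_sc intro!: imageI sc_pathalg)

lemma S_zero: "0 \<in> S"
  unfolding S_def using Phi_zero pathalg_zero by (metis imageI)

lemma S_E: "E v \<in> S"
  unfolding S_def using Phi_triv[of v] pathalg_single[of qs qt v "[]" 1]
  by (metis chain.simps(1) imageI triv_def)

lemma S_R: "R x \<in> S"
  unfolding S_def using Phi_arrow[of x] pathalg_single[of qs qt "qs x" "[x]" 1]
  by (metis arrow_def chain.simps imageI)

lemma S_unit: "x \<in> S \<Longrightarrow> (e0 + e1) * x = x"
  by (auto simp: S_def Phi_unit)

(* T is the left ideal generated by e = e0 + e1, decomposed as a right module over S = e u e. *)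
definition T where "T = {x + g1 * y + g2 * z | x y z. x \<in> S \<and> y \<in> S \<and> z \<in> S}"

lemma T_I: "x \<in> S \<Longrightarrow> y \<in> S \<Longrightarrow> z \<in> S \<Longrightarrow> u = x + g1 * y + g2 * z \<Longrightarrow> u \<in> T"
  by (auto simp: T_def)

lemma T_E: assumes "u \<in> T" obtains x y z where "x \<in> S" "y \<in> S" "z \<in> S" "u = x + g1 * y + g2 * z"
  using assms by (auto simp: T_def)

lemma T_unit: "e0 + e1 \<in> T"
  by (rule T_I[of _ 0 0]) (use S_E[of V0] S_E[of V1] in \<open>auto intro: S_add S_zero\<close>)

lemma T_zero: "0 \<in> T"
  by (rule T_I[OF S_zero S_zero S_zero]) simp

lemma T_add:
  assumes "u \<in> T" "v \<in> T" shows "u + v \<in> T"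
proof -
  obtain x y z where "x \<in> S" "y \<in> S" "z \<in> S" "u = x + g1 * y + g2 * z"
    using assms(1) by (rule T_E)
  moreover obtain x' y' z' where "x' \<in> S" "y' \<in> S" "z' \<in> S" "v = x' + g1 * y' + g2 * z'"
    using assms(2) by (rule T_E)
  ultimately show ?thesis
    by (intro T_I[of "x + x'" "y + y'" "z + z'"] S_add) (simp_all only: distrib_left add_ac)
qed

lemma T_scale:
  assumes "u \<in> T" shows "K k * u \<in> T"
proof -
  obtain x y z where "x \<in> S" "y \<in> S" "z \<in> S" "u = x + g1 * y + g2 * z"
    using assms by (rule T_E)
  then show ?thesis
    by (intro T_I[of "K k * x" "K k * y" "K k * z"] S_scale)
      (simp_all only: distrib_left K_left_commute[of g1] K_left_commute[of g2])
qed

lemma T_a: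
  assumes "u \<in> T" shows "a * u \<in> T"
proof -
  obtain x y z where s: "x \<in> S" "y \<in> S" "z \<in> S" and u: "u = x + g1 * y + g2 * z"
    using assms by (rule T_E)
  \<comment> \<open>Inserting the unit of \<open>S\<close> before \<open>x\<close> splits
    \<open>a * x\<close> into \<open>R be1 * x\<close> and \<open>g1 * x\<close>.\<close>
  have "a * u = a * ((e0 + e1) * x) + a * (g1 * y) + a * (g2 * z)"
    by (simp only: u distrib_left S_unit[OF s(1)])
  also have "\<dots> = (a * e0) * x + g1 * x + g2 * y + (a * g2) * z"
    by (simp only: distrib_left distrib_right mult.assoc)
  also have "\<dots> = (R be1 * x + R al1 * z) + g1 * x + g2 * y"
    by (simp only: generator_rules add_ac)
  finally show ?thesis
    by (intro T_I[of "R be1 * x + R al1 * z" x y]) (use s in \<open>auto intro: S_add S_mult S_R simp del: R.simps\<close>)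
qed

lemma T_b:
  assumes "u \<in> T" shows "b * u \<in> T"
proof -
  obtain x y z where s: "x \<in> S" "y \<in> S" "z \<in> S" and u: "u = x + g1 * y + g2 * z"
    using assms by (rule T_E)
  let ?w = "e1 + R be1 * R al2"
  have w: "?w \<in> S" using S_E[of V1] by (auto intro: S_add S_mult S_R simp del: R.simps)
  have "b * u = b * ((e0 + e1) * x) + b * (g1 * y) + b * (g2 * z)"
    by (simp only: u distrib_left S_unit[OF s(1)])
  also have "\<dots> = (b * e0) * x + (b * e1) * x + (b * g1) * y + (b * g2) * z"
    by (simp only: distrib_left distrib_right mult.assoc)
  also have "\<dots> = (R al2 * x + ?w * y) + g1 * (?w * z) + g2 * (R be2 * x)"
    unfolding generator_rules by (simp only: distrib_left distrib_right mult.assoc add_ac)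
  finally show ?thesis
    by (intro T_I[of "R al2 * x + ?w * y" "?w * z" "R be2 * x"])
      (use s w in \<open>auto intro: S_add S_mult S_R simp del: R.simps\<close>)
qed

text \<open>The relation \<open>a * b + b * a = c\<close> reduces this to stability under
  \<open>a\<close> and \<open>b\<close>.\<close>

lemma T_c: "u \<in> T \<Longrightarrow> c * u \<in> T"
  using T_add[OF T_a[OF T_b] T_b[OF T_a], of u u]
  by (simp only: mult.assoc[symmetric] distrib_right[symmetric] ab)

fun gen_val :: "gen \<Rightarrow> 'r" where
  "gen_val ga = a" | "gen_val gb = b" | "gen_val gc = c"

lemma T_gen: "u \<in> T \<Longrightarrow> gen_val g * u \<in> T"
  by (cases g) (simp_all add: T_a T_b T_c)

text \<open>The idempotent fixes the component in \<open>S\<close> and annihilates \<open>g1\<close>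
  and \<open>g2\<close>.\<close>

lemma corner_T:
  assumes "u \<in> T" shows "(e0 + e1) * u \<in> S"
proof -
  obtain x y z where s: "x \<in> S" "y \<in> S" "z \<in> S" and u: "u = x + g1 * y + g2 * z"
    using assms by (rule T_E)
  have "(e0 + e1) * u = (e0 + e1) * x + ((e0 + e1) * g1) * y + ((e0 + e1) * g2) * z"
    by (simp only: u distrib_left mult.assoc)
  also have "\<dots> = x"
    by (simp only: generator_rules S_unit[OF s(1)]) simp
  finally show ?thesis using s by simp
qed

section \<open>The kernel of the map\<close>

lemma Phi_Irels: "x \<in> Irels \<Longrightarrow> Phi x = 0"
  by (auto simp: Irels_def Phi_qmul Phi_arrow Phi_add R_R arrow_in_pathalg add_self simp del: R.simps)

lemma Phi_Iq: "x \<in> Iq \<Longrightarrow> Phi x = 0"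
proof -
  assume "x \<in> Iq"
  \<comment> \<open>Membership in \<open>kQ\<close> is carried along because \<open>Phi_qmul\<close>
    requires it.\<close>
  then have "x \<in> kQ \<and> Phi x = 0"
    unfolding Iq_def
  proof induction
    case (gen s)
    then show ?case using Irels_subset Phi_Irels by (auto simp: arrow_ideal_pow_def)
  qed (auto simp: pathalg_zero pathalg_add pathalg_qmul Phi_add Phi_qmul)
  then show ?thesis ..
qed

lemma Phi_comb:
  "Phi (comb k0 k1 k2 k3 k4 k5 k6 k7) = K k0 * e0 + K k1 * e1 + K k2 * R al1 + K k3 * R al2
    + K k4 * R be1 + K k5 * R be2 + K k6 * (R al1 * R be2) + K k7 * (R be1 * R al2)"
  using R_E[of al1] R_E[of al2] R_E[of be1] R_E[of be2]
  by (simp add: comb_def Phi_add Phi_single del: R.simps)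

end

text \<open>Nonvanishing cannot be obtained by rewriting with the relations; it is isolated here and
  verified for the quotient by means of explicit modules.\<close>

locale faithful_um_kalgebra = um_kalgebra a b c K
  for a b c :: "'r::{ring,monoid_mult}" and K :: "'k::comm_ring_1 \<Rightarrow> 'r" +
  assumes faithful: "K k * (R al1 * R be2) = 0 \<Longrightarrow> k = 0" "K k * (R be1 * R al2) = 0 \<Longrightarrow> k = 0"
begin

text \<open>Multiply the relation on the right by \<open>s0\<close>, \<open>s1\<close>,
  \<open>R be2\<close>, \<open>R be1\<close>, \<open>R al2\<close>, \<open>R al1\<close>,
  \<open>e0\<close> in this order. Each time a single unknown coefficient survives, in front of
  \<open>s0\<close> or \<open>s1\<close>, and \<open>faithful\<close> makes it zero.\<close>

lemma basis_independent:
  assumes zero: "K k0 * e0 + K k1 * e1 + K k2 * R al1 + K k3 * R al2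
      + K k4 * R be1 + K k5 * R be2 + K k6 * (R al1 * R be2) + K k7 * (R be1 * R al2) = 0"
  shows "k0 = 0" "k1 = 0" "k2 = 0" "k3 = 0" "k4 = 0" "k5 = 0" "k6 = 0" "k7 = 0"
proof -
  \<comment> \<open>Opaque names keep the socle elements intact until \<open>faithful\<close> is
    applied.\<close>
  define s0 s1 where s_def: "s0 = R al1 * R be2" "s1 = R be1 * R al2"
  have s_pbw: "s0 = a * (a * (a * (b * (b * b)))) + a * (a * (a * (b * (b * (b * c)))))"
    "s1 = a * (b * c) + a * (a * (b * (b * c))) + a * (a * (a * (b * (b * (b * c)))))"
    by (simp_all only: s_def socle_pbw)
  have f: "K k * s0 = 0 \<Longrightarrow> k = 0" "K k * s1 = 0 \<Longrightarrow> k = 0" for k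
    using faithful by (simp_all only: s_def)
  note eqs = e_pbw R_pbw s_pbw pbw
  have X: "K k0 * (e0 * z) + K k1 * (e1 * z) + K k2 * (R al1 * z) + K k3 * (R al2 * z)
      + K k4 * (R be1 * z) + K k5 * (R be2 * z) + K k6 * (s0 * z) + K k7 * (s1 * z) = 0" for z
    using arg_cong[OF zero, of "\<lambda>x. x * z"]
    by (simp only: distrib_right mult.assoc mult_zero_left s_def)
  have "e0 * s0 = s0" "e1 * s0 = 0" "R al1 * s0 = 0" "R al2 * s0 = 0" "R be1 * s0 = 0"
    "R be2 * s0 = 0" "s0 * s0 = 0" "s1 * s0 = 0"
    by (simp_all add: eqs del: R.simps)
  with X[of s0] show k0: "k0 = 0" using f(1)[of k0] by (simp del: R.simps)
  have "e0 * s1 = 0" "e1 * s1 = s1" "R al1 * s1 = 0" "R al2 * s1 = 0" "R be1 * s1 = 0"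
    "R be2 * s1 = 0" "s0 * s1 = 0" "s1 * s1 = 0"
    by (simp_all add: eqs del: R.simps)
  with X[of s1] show k1: "k1 = 0" using f(2)[of k1] by (simp del: R.simps)
  have "R al1 * R be2 = s0" "R al2 * R be2 = 0" "R be1 * R be2 = 0"
    "R be2 * R be2 = 0" "s0 * R be2 = 0" "s1 * R be2 = 0"
    by (simp_all add: eqs del: R.simps)
  with X[of "R be2"] show k2: "k2 = 0"
    using f(1)[of k2] by (simp add: k0 k1 K_zero del: R.simps)
  have "R al1 * R be1 = 0" "R al2 * R be1 = s0" "R be1 * R be1 = 0"
    "R be2 * R be1 = 0" "s0 * R be1 = 0" "s1 * R be1 = 0"
    by (simp_all add: eqs del: R.simps)
  with X[of "R be1"] show k3: "k3 = 0"
    using f(1)[of k3] by (simp add: k0 k1 K_zero del: R.simps)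
  have "R be1 * R al2 = s1" "R be2 * R al2 = 0" "s0 * R al2 = 0" "s1 * R al2 = 0"
    by (simp_all add: eqs del: R.simps)
  with X[of "R al2"] show k4: "k4 = 0"
    using f(2)[of k4] by (simp add: k0 k1 k2 k3 K_zero del: R.simps)
  have "R be1 * R al1 = 0" "R be2 * R al1 = s1" "s0 * R al1 = 0" "s1 * R al1 = 0"
    by (simp_all add: eqs del: R.simps)
  with X[of "R al1"] show k5: "k5 = 0"
    using f(2)[of k5] by (simp add: k0 k1 k2 k3 K_zero del: R.simps)
  have "s0 * e0 = s0" "s1 * e0 = 0"
    by (simp_all add: eqs del: R.simps)
  with X[of e0] show k6: "k6 = 0"
    using f(1)[of k6] by (simp add: k0 k1 k2 k3 k4 k5 K_zero del: R.simps)
  with zero show "k7 = 0"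
    using faithful(2)[of k7] by (simp add: k0 k1 k2 k3 k4 k5 K_zero del: R.simps)
qed

text \<open>Reduce to a combination of eight paths; its image vanishes too, so by independence the
  combination itself is zero.\<close>

lemma Phi_kernel:
  assumes "x \<in> kQ"
  shows "Phi x = 0 \<longleftrightarrow> x \<in> Iq"
proof
  assume "Phi x = 0"
  obtain k0 k1 k2 k3 k4 k5 k6 k7 where "x - comb k0 k1 k2 k3 k4 k5 k6 k7 \<in> Iq" (is "x - ?y \<in> _")
    using Iq_comb[OF \<open>x \<in> kQ\<close>] by blast
  moreover from this have "Phi (x - ?y) = 0" by (rule Phi_Iq)
  then have "Phi ?y = 0"
    using Phi_add[of "x - ?y" ?y] \<open>Phi x = 0\<close> by simp
  note zeros = basis_independent[OF this[unfolded Phi_comb]]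
  have "?y = 0" by (simp add: comb_def zeros)
  ultimately show "x \<in> Iq" by simp
qed (rule Phi_Iq)

end


section \<open>Faithfulness on the socle\<close>

(* The module induced from the span of b^j, j < 4, on which c acts as j + l; f i j is the coefficient
   of a^i b^j. The action of b comes from b a^i = a^i b + i a^(i-1) c + (i choose 2) a^(i-1), and
   (i + 1 choose 2) is 0, 1, 1 modulo 2 for i = 0, 1, 2. *)
fun vact :: "'k::comm_ring_1 \<Rightarrow> gen \<Rightarrow> (nat \<Rightarrow> nat \<Rightarrow> 'k) \<Rightarrow> nat \<Rightarrow> nat \<Rightarrow> 'k" where
  "vact l ga f i j = (if 0 < i \<and> i < 4 \<and> j < 4 then f (i - 1) j else 0)"
| "vact l gb f i j = (if i < 4 \<and> j < 4
    then (if 0 < j then f i (j - 1) else 0)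
      + (if i < 3 then (of_nat (Suc i) * (of_nat j + l) + (if i = 0 then 0 else 1)) * f (Suc i) j else 0)
    else 0)"
| "vact l gc f i j = (if i < 4 \<and> j < 4 then (of_nat (i + j) + l) * f i j else 0)"

lemma vact_sum:
  "vact l g (\<lambda>i j. \<Sum>v\<in>V. k v * G v i j) i j = (\<Sum>v\<in>V. k v * vact l g (G v) i j)"
  by (cases g) (auto simp: sum_distrib_left sum.distrib distrib_left mult_ac)

lemma vact_word_sum:
  "foldr (vact l) w (\<lambda>i j. \<Sum>v\<in>V. k v * G v i j) i j
    = (\<Sum>v\<in>V. k v * foldr (vact l) w (G v) i j)"
proof (induction w arbitrary: i j)
  case (Cons g w)
  then have "foldr (vact l) w (\<lambda>i j. \<Sum>v\<in>V. k v * G v i j)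
      = (\<lambda>i j. \<Sum>v\<in>V. k v * foldr (vact l) w (G v) i j)"
    by (intro ext)
  then show ?case by (simp only: foldr.simps o_apply vact_sum)
qed simp

text \<open>With \<open>foldr\<close> the last letter of a word acts first, which makes this a left
  action.\<close>

definition vrep :: "'k::comm_ring_1 \<Rightarrow> 'k fa \<Rightarrow> (nat \<Rightarrow> nat \<Rightarrow> 'k) \<Rightarrow> nat \<Rightarrow> nat \<Rightarrow> 'k" where
  "vrep l x f i j = lext (\<lambda>w k. k * foldr (vact l) w f i j) x"

lemma vrep_single: "vrep l (Poly_Mapping.single w k) f i j = k * foldr (vact l) w f i j"
  by (simp add: vrep_def lext_single)

lemma vrep_gen: "vrep l (fgen g) f = vact l g f"
  by (intro ext) (simp add: fgen_def vrep_single)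

lemma vrep_zero: "vrep l 0 f i j = 0"
  by (simp add: vrep_def)

lemma vrep_add: "vrep l (x + y) f i j = vrep l x f i j + vrep l y f i j"
  unfolding vrep_def by (rule lext_add) (simp_all add: distrib_right)

lemma vrep_diff: "vrep l (x - y) f i j = vrep l x f i j - vrep l y f i j"
  using vrep_add[of l "x - y" y] by simp

lemma vrep_sum: "vrep l (sum F S) f i j = (\<Sum>x\<in>S. vrep l (F x) f i j)"
  unfolding vrep_def by (rule lext_sum) (simp_all add: distrib_right)

lemma vrep_times: "vrep l (x * y) f = vrep l x (vrep l y f)"
proof (intro ext)
  fix i j
  have y: "vrep l y f = (\<lambda>i j. \<Sum>v\<in>Poly_Mapping.keys y. Poly_Mapping.lookup y v * foldr (vact l) v f i j)"
    by (intro ext) (simp add: vrep_def lext_def)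
  have "vrep l (x * y) f i j
      = (\<Sum>u\<in>Poly_Mapping.keys x. \<Sum>v\<in>Poly_Mapping.keys y.
          Poly_Mapping.lookup x u * Poly_Mapping.lookup y v * foldr (vact l) u (foldr (vact l) v f) i j)"
    by (simp add: fmul_def vrep_sum vrep_single flip: fmul_eq_times)
  also have "\<dots> = vrep l x (vrep l y f) i j"
    by (simp add: y vrep_def[of l x] lext_def vact_word_sum sum_distrib_left mult.assoc)
  finally show "vrep l (x * y) f i j = vrep l x (vrep l y f) i j" .
qed

text \<open>The zero function is an empty sum, so linearity applies to it.\<close>

lemma vrep_of_zero: "vrep l x (\<lambda>i j. 0) i j = 0"
  using vact_word_sum[of l _ "\<lambda>_. 0" "\<lambda>_ _ _. 0" "{}"] by (simp add: vrep_def lext_def)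

text \<open>A check on the 16 coordinates. In characteristic 2 the relation for \<open>c\<close>
  asks that \<open>n + l\<close> be idempotent for each integer \<open>n\<close>, which follows from
  \<open>l * l = l\<close>.\<close>

lemma vrep_um_rels:
  assumes two: "(1::'k::comm_ring_1) + 1 = 0" and "l * l = l" and "r \<in> um_rels"
  shows "vrep l r f i j = (0::'k)"
proof -
  have num: "(2::'k) = 0" "(3::'k) = 1" "(4::'k) = 0" "(5::'k) = 1" "(6::'k) = 0"
  proof -
    show 2: "(2::'k) = 0" using two by simp
    have *: "(3::'k) = 2 + 1" "(4::'k) = 2 * 2" "(5::'k) = 2 * 2 + 1" "(6::'k) = 2 * 3"
      by simp_all
    show "(3::'k) = 1" "(4::'k) = 0" "(5::'k) = 1" "(6::'k) = 0"
      by (simp_all only: * 2 mult_zero_left add_0_left)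
  qed
  have double: "x + x = 0" for x :: 'k
    using num(1) by (simp only: mult_2[symmetric] mult_zero_left)
  have add_self: "x + x = 0" "x + (x + y) = y" for x y :: 'k
    by (simp_all add: double flip: add.assoc)
  have minus: "- x = x" "x - y = x + y" for x y :: 'k
    using double[of x] double[of y] minus_unique[of x x] minus_unique[of y y] by simp_all
  have l: "l * (l * x) = l * x" for x
    using \<open>l * l = l\<close> by (simp flip: mult.assoc)
  have less4: "i < 4 \<longleftrightarrow> i = 0 \<or> i = Suc 0 \<or> i = 2 \<or> i = 3" for i :: nat by auto
  note rules = fmul_eq_times fpow_eq_power power4_eq_xxxx
    vrep_times vrep_add vrep_diff vrep_gen
  have "vrep l r f i j = 0" if "i < 4" "j < 4"
    using \<open>r \<in> um_rels\<close> that unfolding um_rels_def less4 insert_iff empty_iff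
    by (elim disjE FalseE; simp add: rules num minus l distrib_left distrib_right mult_ac add_ac
        add_self numeral_2_eq_2[symmetric])
  \<comment> \<open>Every term of a relation begins with a letter, whose action is zero off the
    grid.\<close>
  moreover have "vrep l r f i j = 0" if "\<not> (i < 4 \<and> j < 4)"
    using \<open>r \<in> um_rels\<close> that unfolding um_rels_def
    by (auto simp: rules)
  ultimately show ?thesis by blast
qed

lemma vrep_um_ideal:
  assumes "(1::'k::comm_ring_1) + 1 = 0" "l * l = l" "x \<in> um_ideal"
  shows "vrep l x f i j = (0::'k)"
  using assms(3) unfolding um_ideal_def
\<comment> \<open>In a product \<open>x * u\<close> the factor \<open>u\<close> acts first and
  changes the vector, hence the general \<open>f\<close>.\<close>
proof (induction arbitrary: f i j)
  case (left x u)
  then have "vrep l x f = (\<lambda>i j. 0)" by (intro ext)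
  then show ?case by (simp add: fmul_eq_times vrep_times vrep_of_zero)
qed (simp_all add: vrep_zero vrep_um_rels[OF assms(1,2)] vrep_add fmul_eq_times vrep_times)

lemma abs_um_rels:
  "abs_um (fmul A B + fmul B A - C :: 'k::comm_ring_1 fa) = 0"
  "abs_um (fmul A C + fmul C A - A :: 'k fa) = 0"
  "abs_um (fmul B C + fmul C B - B :: 'k fa) = 0"
  "abs_um (fpow A 4 :: 'k fa) = 0" "abs_um (fpow B 4 :: 'k fa) = 0"
  "abs_um (fmul C C + C :: 'k fa) = 0"
  unfolding abs_um_eq_zero_iff by (rule um_idealI(2), simp add: um_rels_def)+

lemma faithful_um_kalgebra_um:
  assumes char2: "(1::'k::comm_ring_1) + 1 = 0"
  shows "faithful_um_kalgebra (abs_um A) (abs_um B) (abs_um C) (\<lambda>k::'k. abs_um (Poly_Mapping.single [] k))"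
proof -
  interpret um_kalgebra "abs_um A" "abs_um B" "abs_um C" "\<lambda>k::'k. abs_um (Poly_Mapping.single [] k)"
  proof
    have "(1 :: 'k fa) + 1 = 0"
      using char2 by (simp add: fone_def flip: fone_eq_one single_add)
    then show "(1 :: 'k um) + 1 = 0" by (simp flip: abs_um_hom)
    show "abs_um A * abs_um B + abs_um B * abs_um A = (abs_um C :: 'k um)"
      "abs_um A * abs_um C + abs_um C * abs_um A = (abs_um A :: 'k um)"
      "abs_um B * abs_um C + abs_um C * abs_um B = (abs_um B :: 'k um)"
      "abs_um A ^ 4 = (0 :: 'k um)" "abs_um B ^ 4 = (0 :: 'k um)"
      "abs_um C * abs_um C + abs_um C = (0 :: 'k um)"
      using abs_um_rels[where 'k = 'k]
      by (simp_all add: fmul_eq_times fpow_eq_power abs_um_hom abs_um_power)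
    fix k l :: 'k and x :: "'k um"
    show "abs_um (Poly_Mapping.single [] (k + l))
        = (abs_um (Poly_Mapping.single [] k) + abs_um (Poly_Mapping.single [] l) :: 'k um)"
      by (simp add: single_add abs_um_hom)
    show "abs_um (Poly_Mapping.single [] (k * l))
        = (abs_um (Poly_Mapping.single [] k) * abs_um (Poly_Mapping.single [] l) :: 'k um)"
      by (simp add: mult_single plus_list_def flip: abs_um_hom)
    show "abs_um (Poly_Mapping.single [] 1) = (1 :: 'k um)"
      by (simp flip: fone_def abs_um_hom add: fone_eq_one)
    obtain y where "x = abs_um y" using abs_um_rep_um by metis
    then show "abs_um (Poly_Mapping.single [] k) * x = x * abs_um (Poly_Mapping.single [] k)"
      by (simp add: single_central flip: abs_um_hom)
  qed
  show ?thesis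
  proof
    \<comment> \<open>The generating vector of the module, on which \<open>c\<close> acts as
      \<open>l\<close>.\<close>
    let ?d = "\<lambda>i j. if i = 0 \<and> j = 0 then 1 else 0 :: 'k"
    fix k :: 'k
    {
      let ?x = "A * (A * (A * (B * (B * B)))) + A * (A * (A * (B * (B * (B * C))))) :: 'k fa"
      assume "abs_um (Poly_Mapping.single [] k) * (R al1 * R be2) = 0"
      then have "Poly_Mapping.single [] k * ?x \<in> um_ideal"
        unfolding socle_pbw by (simp flip: abs_um_hom abs_um_eq_zero_iff)
      \<comment> \<open>For \<open>l = 0\<close> the element \<open>c\<close> kills
        \<open>?d\<close>, so only \<open>a^3 b^3\<close> remains, and coordinate (3, 3) reads off
        \<open>k\<close>.\<close>
      then have "vrep 0 (Poly_Mapping.single [] k * ?x) ?d 3 3 = 0"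
        by (intro vrep_um_ideal[OF char2]) simp_all
      then show "k = 0"
        by (simp add: vrep_times vrep_single vrep_add vrep_gen numeral_eq_Suc)
    }
    {
      let ?x = "A * (B * C) + A * (A * (B * (B * C))) + A * (A * (A * (B * (B * (B * C))))) :: 'k fa"
      assume "abs_um (Poly_Mapping.single [] k) * (R be1 * R al2) = 0"
      then have "Poly_Mapping.single [] k * ?x \<in> um_ideal"
        unfolding socle_pbw by (simp flip: abs_um_hom abs_um_eq_zero_iff)
      \<comment> \<open>For \<open>l = 1\<close> the element \<open>c\<close> fixes
        \<open>?d\<close>; the three terms land in different coordinates, and only the last one
        reaches (3, 3).\<close>
      then have "vrep 1 (Poly_Mapping.single [] k * ?x) ?d 3 3 = 0"
        by (intro vrep_um_ideal[OF char2]) simp_all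
      then show "k = 0"
        by (simp add: vrep_times vrep_single vrep_add vrep_gen numeral_eq_Suc)
    }
  qed
qed

section \<open>The corner algebra as a special biserial bound quiver algebra\<close>

theorem theorem3p16:
  fixes k_type :: "'k::alg_closed_field itself"
  assumes "CHAR('k) = 2"
  shows "(\<exists>\<phi> :: (qv \<times> qa list \<Rightarrow>\<^sub>0 'k) \<Rightarrow> 'k fa.
            (\<forall>x\<in>kQ. in_umb (\<phi> x))
          \<and> (\<forall>x\<in>kQ. \<forall>y\<in>kQ. umeq (\<phi> (x + y)) (\<phi> x + \<phi> y))
          \<and> (\<forall>c. \<forall>x\<in>kQ. umeq (\<phi> (sc c x)) (sc c (\<phi> x)))
          \<and> (\<forall>x\<in>kQ. \<forall>y\<in>kQ. umeq (\<phi> (qm x y)) (fmul (\<phi> x) (\<phi> y)))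
          \<and> umeq (\<phi> (triv V0 + triv V1)) ue
          \<and> umeq (\<phi> (triv V0)) ue0
          \<and> umeq (\<phi> (triv V1)) ue1
          \<and> umeq (\<phi> (qarr al1)) (fmul (fpow A 3) ue1)
          \<and> umeq (\<phi> (qarr al2)) (fmul B ue1)
          \<and> umeq (\<phi> (qarr be1)) (fmul A ue0)
          \<and> umeq (\<phi> (qarr be2)) (fmul (fpow B 3) ue0)
          \<and> (\<forall>z. in_umb z \<longrightarrow> (\<exists>x\<in>kQ. umeq (\<phi> x) z))
          \<and> (\<forall>x\<in>kQ. umeq (\<phi> x) 0 \<longleftrightarrow> x \<in> (Iq :: (qv \<times> qa list \<Rightarrow>\<^sub>0 'k) set)))
       \<and> special_biserial qs qt (Iq :: (qv \<times> qa list \<Rightarrow>\<^sub>0 'k) set)"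
proof -
  have two: "(1::'k) + 1 = 0"
    using of_nat_CHAR[where 'a = 'k] assms by simp
  interpret faithful_um_kalgebra "abs_um A" "abs_um B" "abs_um C"
    "\<lambda>k::'k. abs_um (Poly_Mapping.single [] k)"
    using two by (rule faithful_um_kalgebra_um)
  \<comment> \<open>Arbitrary representatives suffice, since every identity is required only up to
    \<open>umeq\<close>.\<close>
  define \<phi> where "\<phi> = (\<lambda>x. rep_um (Phi x))"
  have abs_\<phi>: "abs_um (\<phi> x) = Phi x" for x
    by (simp add: \<phi>_def abs_um_rep_um)
  note fa_simps = fmul_eq_times fpow_eq_power fone_eq_one abs_um_hom abs_um_power
  have e0: "abs_um ue0 = e0" and e1: "abs_um ue1 = e1"
    by (simp_all add: ue0_def ue1_def e0_def e1_def fa_simps)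
  have e: "abs_um ue = e0 + e1"
    by (simp add: ue_def e0 e1 abs_um_hom)
  \<comment> \<open>Stability under letters and scalars extends to words by peeling off the first
    letter; the empty word is a scalar.\<close>
  have T_times: "abs_um x * u \<in> T" if "u \<in> T" for x u
  proof -
    have "abs_um (fgen g) * v \<in> T" if "v \<in> T" for g v
      using T_gen[OF that, of g] by (cases g) simp_all
    moreover have "Poly_Mapping.single (g # w) k = fgen g * Poly_Mapping.single w k" for g w and k :: 'k
      by (simp add: fgen_def mult_single plus_list_def)
    ultimately have "abs_um (Poly_Mapping.single w k) * u \<in> T" for w k
      by (induction w) (simp_all add: T_scale \<open>u \<in> T\<close> abs_um_hom mult.assoc)
    then have "lext Poly_Mapping.single x \<in> {x. abs_um x * u \<in> T}"
      by (intro lext_closed) (simp_all add: abs_um_hom distrib_right T_add T_zero)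
    then show ?thesis by (simp add: lext_single_id)
  qed
  have surj: "\<exists>x\<in>kQ. Phi x = abs_um z" if z: "in_umb z" for z
  proof -
    \<comment> \<open>Bracketed this way, the right factor lies in the left ideal \<open>T\<close>,
      and \<open>corner_T\<close> applies.\<close>
    obtain w where "abs_um z = (e0 + e1) * (abs_um w * (e0 + e1))"
      using z by (auto simp: in_umb_def umeq_iff e fa_simps mult.assoc)
    then have "abs_um z \<in> S" by (simp only: corner_T T_times T_unit)
    then show ?thesis by (auto simp: S_def)
  qed
  have corner: "in_umb (\<phi> x)" if "x \<in> kQ" for x
    unfolding in_umb_def
    \<comment> \<open>The element is its own witness, being fixed by the idempotent on both
      sides.\<close>
    by (rule exI[of _ "\<phi> x"]) (simp add: umeq_iff fa_simps e abs_\<phi> Phi_unit that)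
  show ?thesis
    using corner surj special_biserial_Iq
    by (intro conjI exI[of _ \<phi>])
      (simp_all add: umeq_iff fa_simps abs_\<phi> Phi_add Phi_qmul Phi_sc Phi_triv Phi_arrow Phi_kernel
        e0 e1 e sc_eq_times)
qed

end
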